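(* Let $l,r\ge 0$ be integers and let $S$ be the $(p,m,2)$ signed graph consisting of a positive edge, to which are attached $l$ positive pendant edges and $2$ negative pendant edges at one end as well as $r$ positive pendant edges at the other end. If $r<2$ then $S$ is not additively graceful.
   Context: A signed graph $S$ is a finite simple graph on $p$ vertices in which $m$ edges are specified as positive and the remaining $n$ edges are specified as negative; it is then called a $(p,m,n)$ signed graph, with sets of positive and negative edges $E^+(S)$ and $E^-(S)$. Attaching a pendant edge at a vertex $z$ means adding a new vertex of degree 1 joined to $z$. Thus $S$ has positive edges $z_1z_2$, $z_1v_i$ ($1\le i\le l$), $z_2w_i$ ($1\le i\le r$) and negative edges $z_1u_1$, $z_1u_2$, all these vertices being distinct, and no other vertices or edges. An additively graceful labeling of a $(p,m,n)$ signed graph $S=(V,E)$ is an injective map $f:V\to\{0,1,\dots,m+\lceil\frac{n+1}{2}\rceil\}$ such that, with $f^*(uv)=f(u)+f(v)$ for $uv\in E^-(S)$ and $f^*(uv)=|f(u)-f(v)|$ for $uv\in E^+(S)$, one has $\{f^*(uv):uv\in E^-(S)\}=\{1,2,\dots,n\}$ and $\{f^*(uv):uv\in E^+(S)\}=\{1,2,\dots,m\}$. $S$ is additively graceful if it admits such a labeling. *)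

theory Defs
  imports Complex_Main
begin

record 'a signed_graph =
  sg_verts :: "'a set"
  sg_pos :: "'a set set"
  sg_neg :: "'a set set"

text \<open>Edges are two-element vertex sets, so loops and multiple edges are excluded; disjointness
  says that every edge has exactly one sign.\<close>

definition signed_graph :: "'a signed_graph \<Rightarrow> bool" where
  "signed_graph S \<longleftrightarrow>
     finite (sg_verts S) \<and>
     (\<forall>e \<in> sg_pos S \<union> sg_neg S. e \<subseteq> sg_verts S \<and> card e = 2) \<and>
     sg_pos S \<inter> sg_neg S = {}"

definition pmn_signed_graph :: "nat \<Rightarrow> nat \<Rightarrow> nat \<Rightarrow> 'a signed_graph \<Rightarrow> bool" where
  "pmn_signed_graph p m n S \<longleftrightarrow>
     signed_graph S \<and> card (sg_verts S) = p \<and> card (sg_pos S) = m \<and> card (sg_neg S) = n"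

text \<open>Only the values of \<open>f\<close> on the vertex set matter. The positive edge labels are taken in
  \<open>int\<close> because subtraction on \<open>nat\<close> truncates.\<close>

definition additively_graceful_labeling :: "'a signed_graph \<Rightarrow> ('a \<Rightarrow> nat) \<Rightarrow> bool" where
  "additively_graceful_labeling S f \<longleftrightarrow>
     (let m = card (sg_pos S); n = card (sg_neg S) in
        inj_on f (sg_verts S) \<and>
        f ` sg_verts S \<subseteq> {0..m + nat \<lceil>(real n + 1) / 2\<rceil>} \<and>
        {f a + f b | a b. {a, b} \<in> sg_neg S} = {1..n} \<and>
        {\<bar>int (f a) - int (f b)\<bar> | a b. {a, b} \<in> sg_pos S} = {1..int m})"

definition additively_graceful :: "'a signed_graph \<Rightarrow> bool" where
  "additively_graceful S \<longleftrightarrow> (\<exists>f. additively_graceful_labeling S f)"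

end

theory Submission
  imports Defs
begin

text \<open>
  The two negative labels \<open>f z\<^sub>1 + f u\<^sub>1\<close> and \<open>f z\<^sub>1 + f u\<^sub>2\<close> are 1 and 2, which forces \<open>f z\<^sub>1 = 0\<close>
  and \<open>{f u\<^sub>1, f u\<^sub>2} = {1, 2}\<close>: the values 0, 1, 2 are used up on \<open>z\<^sub>1, u\<^sub>1, u\<^sub>2\<close>
  (lemma \<open>vertex_labels_of_sums_1_2\<close>). Every other vertex therefore has a value of at least 3,
  and so every positive edge at \<open>z\<^sub>1\<close> has a label of at least 3. The positive labels 1 and 2, as far
  as they are required, must come from the \<open>r\<close> pendant edges at \<open>z\<^sub>2\<close>. For \<open>r = 0\<close> there is no
  such edge, while label 1 is required because \<open>z\<^sub>1z\<^sub>2\<close> is positive; for \<open>r = 1\<close> there is one such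
  edge, while both labels are required because there are at least two positive edges.
\<close>

text \<open>A common summand \<open>x \<ge> 2\<close> makes the sum 1 impossible, and \<open>x = 1\<close> can only produce the sum 2
  by repeating the value 1, which injectivity forbids.\<close>

lemma vertex_labels_of_sums_1_2:
  fixes x a b :: nat
  assumes sums: "{x + a, x + b} = {1, 2}" and "a \<noteq> x" "b \<noteq> x"
  shows "x = 0" "{a, b} = {1, 2}"
proof -
  have "x + a = 1 \<and> x + b = 2 \<or> x + a = 2 \<and> x + b = 1"
    using sums by (simp add: doubleton_eq_iff)
  then have "x = 0 \<and> (a = 1 \<and> b = 2 \<or> a = 2 \<and> b = 1)"
    using assms(2,3) by presburger
  then show "x = 0" "{a, b} = {1, 2}" by auto
qed

theorem theorem4p1:
  fixes S :: "'a signed_graph"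
    and l r p m :: nat
    and z1 z2 u1 u2 :: 'a
    and v w :: "nat \<Rightarrow> 'a"
  assumes "pmn_signed_graph p m 2 S"
    and "distinct ([z1, z2, u1, u2] @ map v [1..<l + 1] @ map w [1..<r + 1])"
    and "sg_verts S = {z1, z2, u1, u2} \<union> v ` {1..l} \<union> w ` {1..r}"
    and "sg_pos S = {{z1, z2}} \<union> (\<lambda>i. {z1, v i}) ` {1..l} \<union> (\<lambda>i. {z2, w i}) ` {1..r}"
    and "sg_neg S = {{z1, u1}, {z1, u2}}"
    and "r < 2"
  shows "\<not> additively_graceful S"
proof
  assume "additively_graceful S"
  then obtain f where "additively_graceful_labeling S f"
    by (auto simp: additively_graceful_def)
  moreover have "card (sg_neg S) = 2"
    using assms(1) by (simp add: pmn_signed_graph_def)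
  ultimately have inj: "inj_on f (sg_verts S)"
    and neg: "{f a + f b | a b. {a, b} \<in> sg_neg S} = {1..2}"
    and pos: "{\<bar>int (f a) - int (f b)\<bar> | a b. {a, b} \<in> sg_pos S} = {1..int (card (sg_pos S))}"
    by (simp_all add: additively_graceful_labeling_def Let_def)
  have v_new: "v i \<notin> {z1, z2, u1, u2}" if "i \<in> {1..l}" for i
    using assms(2) that by (auto simp del: upt_Suc)
  have dist: "distinct [z1, z2, u1, u2]"
    using assms(2) by simp

  have "{f a + f b | a b. {a, b} \<in> sg_neg S} = {f z1 + f u1, f z1 + f u2}" (is "?L = ?R")
  proof
    show "?L \<subseteq> ?R" unfolding assms(5) by (auto simp: doubleton_eq_iff)
    show "?R \<subseteq> ?L" unfolding assms(5) by blast
  qed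
  with neg have sums: "{f z1 + f u1, f z1 + f u2} = {1, 2}"
    by (simp add: numeral_2_eq_2 atLeastAtMostSuc_conv insert_commute)
  have ne: "f u1 \<noteq> f z1" "f u2 \<noteq> f z1"
    using dist assms(3) by (auto simp: inj_on_eq_iff[OF inj])
  note z1_0 = vertex_labels_of_sums_1_2(1)[OF sums ne]
    and u12 = vertex_labels_of_sums_1_2(2)[OF sums ne]

  have large: "f x \<ge> 3" if "x \<in> sg_verts S" "x \<notin> {z1, u1, u2}" for x
  proof -
    have "f x \<notin> {f z1, f u1, f u2}"
      using that assms(3) by (simp add: inj_on_eq_iff[OF inj])
    then have "f x \<noteq> 0" "f x \<noteq> 1" "f x \<noteq> 2" using z1_0 u12 by auto
    then show ?thesis by simp
  qed

  \<comment> \<open>Since \<open>f z1 = 0\<close>, a positive edge at \<open>z1\<close> is labeled by the value at its other end, which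
    is at least 3; only the pendant edges at \<open>z2\<close> remain for the labels 1 and 2.\<close>
  have small_label: "\<exists>i \<in> {1..r}. k = \<bar>int (f z2) - int (f (w i))\<bar>"
    if k: "1 \<le> k" "k \<le> 2" "k \<le> int (card (sg_pos S))" for k
  proof -
    obtain a b where ab: "{a, b} \<in> sg_pos S" "k = \<bar>int (f a) - int (f b)\<bar>"
    proof -
      have "k \<in> {\<bar>int (f a) - int (f b)\<bar> | a b. {a, b} \<in> sg_pos S}"
        unfolding pos using k by simp
      then show ?thesis using that by blast
    qed
    have at_z1: "{a, b} \<noteq> {z1, y}" if "y \<in> sg_verts S" "y \<notin> {z1, u1, u2}" for y
      using large[OF that] z1_0 ab(2) k by (auto simp: doubleton_eq_iff)
    have "{a, b} \<noteq> {z1, z2}" using at_z1[of z2] dist assms(3) by auto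
    moreover have "{a, b} \<noteq> {z1, v i}" if "i \<in> {1..l}" for i
      using at_z1[of "v i"] v_new[OF that] that assms(3) by auto
    ultimately obtain i where "i \<in> {1..r}" "{a, b} = {z2, w i}"
      using ab(1) unfolding assms(4) by blast
    then show ?thesis using ab(2) by (auto simp: doubleton_eq_iff abs_minus_commute)
  qed

  have fin_pos: "finite (sg_pos S)" unfolding assms(4) by simp
  have "card (sg_pos S) \<ge> 1"
    using fin_pos assms(4) by (auto simp: Suc_le_eq card_gt_0_iff)
  then obtain i where i: "i \<in> {1..r}" "1 = \<bar>int (f z2) - int (f (w i))\<bar>"
    using small_label[of 1] by auto
  then have r: "r = 1" using assms(6) by simp
  have "w 1 \<noteq> z1" using assms(2) r by auto
  then have "{z1, z2} \<noteq> {z2, w 1}" using dist by (auto simp: doubleton_eq_iff)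
  then have "card {{z1, z2}, {z2, w 1}} = 2" by simp
  moreover have "{{z1, z2}, {z2, w 1}} \<subseteq> sg_pos S" unfolding assms(4) r by auto
  ultimately have "card (sg_pos S) \<ge> 2" using card_mono[OF fin_pos] by metis
  then obtain j where "j \<in> {1..r}" "2 = \<bar>int (f z2) - int (f (w j))\<bar>"
    using small_label[of 2] by auto
  with i r show False by simp
qed

end
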